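(* Fix $n\in\mathbb{N}$, $n\ge 1$, and let $\varrho=(\rho_1,\dots,\rho_n)\in\mathcal{D}(\mathbb{C}^2)^n$ be an $n$-tuple of single-qubit density matrices. Then $\varrho\notin\mathcal{R}_n(\mathbb{C}^2)$ if and only if there exist labels $k,l,m\in\{1,\dots,n\}$ such that $\operatorname{Tr}(\rho_k\rho_l\rho_m)\notin\mathfrak{B}_3|_{\mathrm{real}}$.
   Context: $\mathcal{D}(\mathbb{C}^d)$ is the set of density matrices (positive semidefinite, trace one) on $\mathbb{C}^d$. An $n$-tuple $(\rho_1,\dots,\rho_n)$ of density matrices on $\mathbb{C}^d$ is imaginarity-free if there is an orthonormal basis $\{|a_i\rangle\}_{i=1}^d$ of $\mathbb{C}^d$ such that $\langle a_i|\rho_k|a_j\rangle\in\mathbb{R}$ for all $i,j$ and all $k$; $\mathcal{R}_n(\mathbb{C}^d)$ denotes the set of imaginarity-free $n$-tuples. $\mathfrak{B}_3|_{\mathrm{real}}\subseteq\mathbb{R}$ is the set of all numbers of the form $\operatorname{Tr}(\tau_1\tau_2\tau_3)$ where $(\tau_1,\tau_2,\tau_3)\in\mathcal{R}_3(\mathbb{C}^d)$ for some $d\ge 2$; it is equal to the interval $[-\tfrac18,1]$. *)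

theory Defs
  imports "Jordan_Normal_Form.Schur_Decomposition" "HOL-Library.FuncSet"
begin

definition mat_trace :: "complex mat \<Rightarrow> complex" where
  "mat_trace A = (\<Sum>i<dim_row A. A $$ (i, i))"

text \<open>The library product \<open>v \<bullet>c w\<close> conjugates its second argument, so the matrix
  element written \<open>\<langle>w|A|v\<rangle>\<close> in bra-ket notation is \<open>(A *\<^sub>v v) \<bullet>c w\<close>.\<close>

definition braket :: "complex vec \<Rightarrow> complex mat \<Rightarrow> complex vec \<Rightarrow> complex" where
  "braket w A v = (A *\<^sub>v v) \<bullet>c w"

text \<open>In the order on the complex numbers, \<open>0 \<le> z\<close> says that \<open>z\<close> is real and nonnegative.\<close>

definition positive_semidefinite :: "nat \<Rightarrow> complex mat \<Rightarrow> bool" where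
  "positive_semidefinite d A \<longleftrightarrow>
     A \<in> carrier_mat d d \<and> mat_adjoint A = A \<and> (\<forall>v\<in>carrier_vec d. 0 \<le> braket v A v)"

definition density_matrices :: "nat \<Rightarrow> complex mat set" where
  "density_matrices d = {\<rho>. positive_semidefinite d \<rho> \<and> mat_trace \<rho> = 1}"

definition orthonormal_basis :: "nat \<Rightarrow> (nat \<Rightarrow> complex vec) \<Rightarrow> bool" where
  "orthonormal_basis d a \<longleftrightarrow>
     vectorspace.basis class_ring (module_vec TYPE(complex) d) (a ` {..<d}) \<and>
     (\<forall>i<d. \<forall>j<d. a i \<bullet>c a j = (if i = j then 1 else 0))"

text \<open>An \<open>n\<close>-tuple is a function on \<open>{1..n}\<close>, extensional so that tuples are determined by
  their entries.\<close>

definition imaginarity_free :: "nat \<Rightarrow> nat \<Rightarrow> (nat \<Rightarrow> complex mat) set" where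
  "imaginarity_free n d =
     {\<rho> \<in> {1..n} \<rightarrow>\<^sub>E density_matrices d.
        \<exists>a. orthonormal_basis d a \<and>
          (\<forall>k\<in>{1..n}. \<forall>i<d. \<forall>j<d. braket (a i) (\<rho> k) (a j) \<in> \<real>)}"

text \<open>Typed as a set of complex numbers because traces are complex; that all of its elements
  are real is a consequence of the definition.\<close>

definition B3_real :: "complex set" where
  "B3_real = {mat_trace (\<tau> 1 * \<tau> 2 * \<tau> 3) | \<tau> d. 2 \<le> d \<and> \<tau> \<in> imaginarity_free 3 d}"

end

theory Submission
  imports Defs "Jordan_Normal_Form.DL_Rank"
begin

text \<open>Traces of products do not depend on the basis, so every element of \<open>B3_real\<close> is real. For
  qubits the imaginary part of \<open>Tr(\<rho>\<^sub>k \<rho>\<^sub>l \<rho>\<^sub>m)\<close> is, up to a constant factor, the triple product of the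
  Bloch vectors, so if all these traces are real, the Bloch vectors lie in a plane through the
  origin. The unitary that turns a unit normal of this plane into the \<open>y\<close>-axis makes all
  the matrices real at once.\<close>

section \<open>Traces and adjoints of complex matrices\<close>

lemma mat_trace_mult_comm:
  assumes "A \<in> carrier_mat n m" "B \<in> carrier_mat m n"
  shows "mat_trace (A * B) = mat_trace (B * A)"
proof -
  have "mat_trace (A * B) = (\<Sum>i<n. \<Sum>j<m. A $$ (i,j) * B $$ (j,i))"
    using assms by (simp add: mat_trace_def scalar_prod_def atLeast0LessThan)
  also have "\<dots> = (\<Sum>j<m. \<Sum>i<n. A $$ (i,j) * B $$ (j,i))"
    by (rule sum.swap)
  also have "\<dots> = mat_trace (B * A)"
    using assms by (simp add: mat_trace_def scalar_prod_def atLeast0LessThan mult.commute)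
  finally show ?thesis .
qed

lemma mat_adjoint_index:
  assumes "A \<in> carrier_mat n m" "i < m" "j < n"
  shows "mat_adjoint A $$ (i, j) = conjugate (A $$ (j, i))"
  using assms by (simp add: mat_adjoint_def mat_of_rows_index)

lemma mat_adjoint_carrier:
  assumes "A \<in> carrier_mat n m"
  shows "mat_adjoint A \<in> carrier_mat m n"
  using assms by (auto simp: mat_adjoint_def intro!: carrier_matI)

section \<open>Orthonormal bases as unitary matrices\<close>

abbreviation basis_mat :: "nat \<Rightarrow> (nat \<Rightarrow> complex vec) \<Rightarrow> complex mat" where
  "basis_mat d a \<equiv> mat_of_cols d (map a [0..<d])"

lemma basis_mat_carrier: "basis_mat d a \<in> carrier_mat d d"
  using mat_of_cols_carrier(1)[of d "map a [0..<d]"] by simp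

text \<open>Row \<open>i\<close> of the adjoint is the conjugate of \<open>a i\<close>, and column
  \<open>j\<close> of \<open>A * basis_mat d a\<close> is \<open>A\<close> applied to
  \<open>a j\<close>. Conjugating by the basis matrix thus produces the matrix elements that occur
  in \<open>imaginarity_free\<close>; for the identity matrix it produces the Gram matrix.\<close>

lemma basis_mat_adjoint_conj_index:
  assumes a: "\<And>i. i < d \<Longrightarrow> a i \<in> carrier_vec d"
    and A: "A \<in> carrier_mat d d" and i: "i < d" and j: "j < d"
  shows "(mat_adjoint (basis_mat d a) * (A * basis_mat d a)) $$ (i, j) = braket (a i) A (a j)"
proof -
  let ?U = "basis_mat d a"
  have U: "?U \<in> carrier_mat d d" by (rule basis_mat_carrier)
  have row: "row (mat_adjoint ?U) i = conjugate (a i)"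
  proof (rule eq_vecI)
    fix k assume "k < dim_vec (conjugate (a i))"
    then have "k < d" using a[OF i] by simp
    then show "row (mat_adjoint ?U) i $ k = conjugate (a i) $ k"
      using a[OF i] i carrier_matD[OF mat_adjoint_carrier[OF U]]
      by (simp add: mat_adjoint_index[OF U] mat_of_cols_index)
  qed (use a[OF i] carrier_matD[OF mat_adjoint_carrier[OF U]] in simp)
  have col: "col (A * ?U) j = A *\<^sub>v a j"
    using a[OF j] j A by (simp add: col_mult2[OF A U j])
  have "(mat_adjoint ?U * (A * ?U)) $$ (i, j) = row (mat_adjoint ?U) i \<bullet> col (A * ?U) j"
    using i j A carrier_matD[OF mat_adjoint_carrier[OF U]] by simp
  also have "\<dots> = braket (a i) A (a j)"
    unfolding row col braket_def
    using a[OF i] a[OF j] A by (intro comm_scalar_prod[of _ d]) auto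
  finally show ?thesis .
qed

lemma basis_mat_unitary:
  assumes a: "\<And>i. i < d \<Longrightarrow> a i \<in> carrier_vec d"
    and o: "\<And>i j. i < d \<Longrightarrow> j < d \<Longrightarrow> a i \<bullet>c a j = (if i = j then 1 else 0)"
  shows "mat_adjoint (basis_mat d a) * basis_mat d a = 1\<^sub>m d"
proof (rule eq_matI)
  let ?U = "basis_mat d a"
  have U: "?U \<in> carrier_mat d d" by (rule basis_mat_carrier)
  note U' = mat_adjoint_carrier[OF U]
  show "dim_row (mat_adjoint ?U * ?U) = dim_row (1\<^sub>m d)"
    "dim_col (mat_adjoint ?U * ?U) = dim_col (1\<^sub>m d)" using U' by auto
  fix i j assume "i < dim_row (1\<^sub>m d)" "j < dim_col (1\<^sub>m d)"
  then have ij: "i < d" "j < d" by auto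
  have "(mat_adjoint ?U * ?U) $$ (i, j) = braket (a i) (1\<^sub>m d) (a j)"
    using basis_mat_adjoint_conj_index[OF a one_carrier_mat ij] U by simp
  \<comment> \<open>The bracket equals \<open>a j \<bullet>c a i\<close>, since the second argument
    is the conjugated one; hence the swapped indices in \<open>o\<close>.\<close>
  also have "\<dots> = 1\<^sub>m d $$ (i, j)"
    using o[OF ij(2,1)] ij a by (simp add: braket_def)
  finally show "(mat_adjoint ?U * ?U) $$ (i, j) = 1\<^sub>m d $$ (i, j)" .
qed

text \<open>A vector in the kernel of the basis matrix is fixed by the product of the adjoint with
  that matrix, which is the identity, so it vanishes. The columns are therefore independent, and
  \<open>d\<close> independent vectors span a space of dimension \<open>d\<close>.\<close>

lemma orthonormal_basisI:
  assumes a: "\<And>i. i < d \<Longrightarrow> a i \<in> carrier_vec d"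
    and o: "\<And>i j. i < d \<Longrightarrow> j < d \<Longrightarrow> a i \<bullet>c a j = (if i = j then 1 else 0)"
  shows "orthonormal_basis d a"
proof -
  interpret vec_space "TYPE(complex)" d .
  let ?U = "basis_mat d a"
  have U: "?U \<in> carrier_mat d d" by (rule basis_mat_carrier)
  note U' = mat_adjoint_carrier[OF U]
  have cols: "cols ?U = map a [0..<d]" using a by (intro cols_mat_of_cols) auto
  \<comment> \<open>Equal vectors at distinct indices would have inner product both 0 and 1.\<close>
  have inj: "inj_on a {..<d}"
    using o by (auto intro!: inj_onI) (metis zero_neq_one)
  have set: "set (cols ?U) = a ` {..<d}" by (simp add: cols atLeast0LessThan)
  have dist: "distinct (cols ?U)" using inj by (simp add: cols distinct_map atLeast0LessThan)
  have "lin_indpt (set (cols ?U))"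
  proof
    assume "lin_dep (set (cols ?U))"
    then obtain v where v: "v \<in> carrier_vec d" "v \<noteq> 0\<^sub>v d" "?U *\<^sub>v v = 0\<^sub>v d"
      using lin_depE[OF U _ dist] by blast
    have "v = (mat_adjoint ?U * ?U) *\<^sub>v v"
      using basis_mat_unitary[OF a o] v by simp
    also have "\<dots> = mat_adjoint ?U *\<^sub>v (?U *\<^sub>v v)"
      using U U' v by (intro assoc_mult_mat_vec) auto
    also have "\<dots> = 0\<^sub>v d" using v U' by auto
    finally show False using v by simp
  qed
  then have "basis (a ` {..<d})"
    unfolding set using a inj
    by (intro dim_li_is_basis) (auto simp: card_image dim_is_n)
  then show ?thesis using o by (simp add: orthonormal_basis_def)
qed

lemma orthonormal_basis_carrier:
  assumes "orthonormal_basis d a" "i < d"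
  shows "a i \<in> carrier_vec d"
proof -
  interpret vec_space "TYPE(complex)" d .
  have "basis (a ` {..<d})" using assms(1) by (simp add: orthonormal_basis_def)
  then have "a ` {..<d} \<subseteq> carrier_vec d" by (simp add: basis_def)
  then show ?thesis using assms(2) by blast
qed

section \<open>Real traces of imaginarity-free triples\<close>

lemma real_entries_mult:
  assumes "A \<in> carrier_mat n n" "B \<in> carrier_mat n n"
    and "\<And>i j. i < n \<Longrightarrow> j < n \<Longrightarrow> A $$ (i, j) \<in> \<real>"
    and "\<And>i j. i < n \<Longrightarrow> j < n \<Longrightarrow> B $$ (i, j) \<in> \<real>"
    and "i < n" "j < n"
  shows "(A * B) $$ (i, j) \<in> \<real>"
proof -
  have "(A * B) $$ (i, j) = (\<Sum>k<n. A $$ (i, k) * B $$ (k, j))"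
    using assms(1,2,5,6) by (simp add: scalar_prod_def atLeast0LessThan)
  also have "\<dots> \<in> \<real>"
    using assms(3-6) by (intro sum_in_Reals Reals_mult) auto
  finally show ?thesis .
qed

text \<open>In the basis that witnesses freeness the three matrices have real entries, so their
  product has a real trace. Cyclicity of the trace carries this back to the original
  matrices.\<close>

lemma B3_real_subset_Reals: "B3_real \<subseteq> \<real>"
proof
  fix z assume "z \<in> B3_real"
  then obtain \<tau> d where z: "z = mat_trace (\<tau> 1 * \<tau> 2 * \<tau> 3)" and \<tau>: "\<tau> \<in> imaginarity_free 3 d"
    unfolding B3_real_def by blast
  obtain a where a: "orthonormal_basis d a"
    and real: "\<And>k i j. k \<in> {1..3} \<Longrightarrow> i < d \<Longrightarrow> j < d \<Longrightarrow> braket (a i) (\<tau> k) (a j) \<in> \<real>"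
    using \<tau> unfolding imaginarity_free_def by blast
  have \<tau>c: "\<tau> k \<in> carrier_mat d d" if "k \<in> {1..3}" for k
    using \<tau> that
    by (auto simp: imaginarity_free_def density_matrices_def positive_semidefinite_def dest!: PiE_mem)
  note ac = orthonormal_basis_carrier[OF a]
  define U where "U = basis_mat d a"
  define W where "W = mat_adjoint U"
  have U: "U \<in> carrier_mat d d" unfolding U_def by (rule basis_mat_carrier)
  have W: "W \<in> carrier_mat d d" unfolding W_def by (rule mat_adjoint_carrier[OF U])
  have WU: "W * U = 1\<^sub>m d"
    using a basis_mat_unitary[OF ac] by (simp add: W_def U_def orthonormal_basis_def)
  \<comment> \<open>For square matrices a left inverse is a right inverse. This order of the factors
    is what cancels between two adjacent conjugated matrices in \<open>conj_mult\<close>.\<close>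
  have UW: "U * W = 1\<^sub>m d" by (rule mat_mult_left_right_inverse[OF W U WU])
  \<comment> \<open>\<open>S k\<close> is \<open>\<tau> k\<close> written in the basis
    \<open>a\<close>.\<close>
  define S where "S k = W * (\<tau> k * U)" for k
  have Sc: "S k \<in> carrier_mat d d" if "k \<in> {1..3}" for k
    using \<tau>c[OF that] U W by (simp add: S_def)
  have Sreal: "S k $$ (i, j) \<in> \<real>" if "k \<in> {1..3}" "i < d" "j < d" for k i j
    using real[OF that] basis_mat_adjoint_conj_index[OF ac \<tau>c[OF that(1)] that(2,3)]
    by (simp add: S_def W_def U_def)
  have conj_mult: "(W * (A * U)) * (W * (B * U)) = W * ((A * B) * U)"
    if A: "A \<in> carrier_mat d d" and B: "B \<in> carrier_mat d d" for A B
  proof -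
    have "(W * (A * U)) * (W * (B * U)) = W * (A * ((U * W) * (B * U)))"
      using A B U W by (simp add: assoc_mult_mat[of _ d d _ d _ d])
    also have "\<dots> = W * ((A * B) * U)"
      unfolding UW using A B U W by (simp add: assoc_mult_mat[of _ d d _ d _ d])
    finally show ?thesis .
  qed
  have c: "\<tau> 1 \<in> carrier_mat d d" "\<tau> 2 \<in> carrier_mat d d" "\<tau> 3 \<in> carrier_mat d d"
    using \<tau>c by auto
  let ?T = "\<tau> 1 * \<tau> 2 * \<tau> 3"
  have T: "?T \<in> carrier_mat d d" using c by simp
  have "mat_trace (W * (?T * U)) = mat_trace (?T * (U * W))"
    using mat_trace_mult_comm[OF W, of "?T * U"] T U W
    by (simp add: assoc_mult_mat[of _ d d _ d _ d])
  then have "z = mat_trace (W * (?T * U))"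
    by (simp only: z UW right_mult_one_mat[OF T])
  also have "\<dots> = mat_trace (S 1 * S 2 * S 3)"
    using c by (simp add: S_def conj_mult)
  also have "\<dots> \<in> \<real>"
  proof -
    have S: "S 1 \<in> carrier_mat d d" "S 2 \<in> carrier_mat d d" "S 3 \<in> carrier_mat d d"
      by (simp_all add: Sc)
    have S12: "(S 1 * S 2) $$ (i, j) \<in> \<real>" if "i < d" "j < d" for i j
      by (rule real_entries_mult[OF S(1,2) _ _ that]) (simp_all add: Sreal)
    have "(S 1 * S 2 * S 3) $$ (i, i) \<in> \<real>" if "i < d" for i
      by (rule real_entries_mult[OF mult_carrier_mat[OF S(1,2)] S(3) S12 Sreal that that]) simp_all
    then show ?thesis
      unfolding mat_trace_def using S by (intro sum_in_Reals) simp
  qed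
  finally show "z \<in> \<real>" .
qed

section \<open>Planes and unit vectors in real 3-space\<close>

text \<open>The assumption says that every triple product vanishes. A nonzero cross product of two
  of the vectors is therefore orthogonal to all of them; if there is none, the vectors lie on a
  common line. Dividing by the length gives the unit normal.\<close>

lemma coplanar_unit_normal:
  fixes x y z :: "'a \<Rightarrow> real"
  assumes det: "\<And>k l m. k \<in> K \<Longrightarrow> l \<in> K \<Longrightarrow> m \<in> K \<Longrightarrow>
      (y k * z l - z k * y l) * x m + (z k * x l - x k * z l) * y m + (x k * y l - y k * x l) * z m = 0"
  obtains \<alpha> \<beta> \<gamma> where "\<alpha>\<^sup>2 + \<beta>\<^sup>2 + \<gamma>\<^sup>2 = 1"
    and "\<And>m. m \<in> K \<Longrightarrow> \<alpha> * x m + \<beta> * y m + \<gamma> * z m = 0"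
proof -
  have "\<exists>a b c. (a, b, c) \<noteq> (0, 0, 0) \<and> (\<forall>m\<in>K. a * x m + b * y m + c * z m = 0)"
  proof (cases "\<exists>k\<in>K. \<exists>l\<in>K.
      (y k * z l - z k * y l, z k * x l - x k * z l, x k * y l - y k * x l) \<noteq> (0, 0, 0)")
    case True
    then show ?thesis using det by blast
  next
    case False
    then have par: "y k * z l - z k * y l = 0" "x k * y l - y k * x l = 0" if "k \<in> K" "l \<in> K" for k l
      using that by auto
    \<comment> \<open>All vectors are now parallel. If one of them is off the z-axis, rotating its
      projection to the xy-plane by a right angle gives a normal to it and so to all; otherwise all
      lie on the z-axis and the x-direction is normal.\<close>
    show ?thesis
    proof (cases "\<exists>k\<in>K. x k \<noteq> 0 \<or> y k \<noteq> 0")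
      case True
      then obtain k where "k \<in> K" "(- y k, x k, 0) \<noteq> (0, 0, 0)" by auto
      moreover have "\<forall>m\<in>K. - y k * x m + x k * y m + 0 * z m = 0"
        using par(2)[OF \<open>k \<in> K\<close>] by (simp add: algebra_simps)
      ultimately show ?thesis by blast
    next
      case False
      then have "((1::real), (0::real), (0::real)) \<noteq> (0, 0, 0) \<and> (\<forall>m\<in>K. 1 * x m + 0 * y m + 0 * z m = 0)"
        by simp
      then show ?thesis by blast
    qed
  qed
  then obtain a b c where nz: "(a, b, c) \<noteq> (0, 0, 0)"
    and orth: "\<And>m. m \<in> K \<Longrightarrow> a * x m + b * y m + c * z m = 0" by blast
  define r where "r = sqrt (a\<^sup>2 + b\<^sup>2 + c\<^sup>2)"
  have "a\<^sup>2 + b\<^sup>2 + c\<^sup>2 > 0"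
    using nz by (auto simp: add_pos_nonneg add_nonneg_pos)
  then have r: "r > 0" "r\<^sup>2 = a\<^sup>2 + b\<^sup>2 + c\<^sup>2" by (auto simp: r_def)
  show ?thesis
  proof
    show "(a / r)\<^sup>2 + (b / r)\<^sup>2 + (c / r)\<^sup>2 = 1"
      using r(1) by (simp add: power_divide add_divide_distrib[symmetric] r(2)[symmetric])
    fix m assume "m \<in> K"
    have "a / r * x m + b / r * y m + c / r * z m = (a * x m + b * y m + c * z m) / r"
      by (simp add: add_divide_distrib)
    then show "a / r * x m + b / r * y m + c / r * z m = 0"
      using orth[OF \<open>m \<in> K\<close>] by simp
  qed
qed

text \<open>The triple on the left-hand sides gives the coefficients of the Bloch coordinates in
  \<open>2 Im \<langle>a\<^sub>0|\<rho>|a\<^sub>1\<rangle>\<close> for \<open>a\<^sub>0 = (p + iq, b)\<close> and \<open>a\<^sub>1 = (-b, p - iq)\<close>.\<close>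

lemma unit_vector_parametrization:
  fixes \<alpha> \<beta> \<gamma> :: real
  assumes "\<alpha>\<^sup>2 + \<beta>\<^sup>2 + \<gamma>\<^sup>2 = 1"
  obtains p q b :: real where "p\<^sup>2 + q\<^sup>2 + b\<^sup>2 = 1"
    and "- 2 * p * q = \<alpha>" and "p\<^sup>2 - q\<^sup>2 + b\<^sup>2 = \<beta>" and "2 * q * b = \<gamma>"
proof (cases "\<beta> = 1")
  case True
  then have "\<alpha> = 0" "\<gamma> = 0" using assms by (auto simp: add_nonneg_eq_0_iff)
  then show ?thesis using that[of 1 0 0] True by simp
next
  case False
  have "\<beta>\<^sup>2 \<le> 1" using assms by (smt (verit) zero_le_power2)
  then have "\<beta> < 1" using False by (simp add: abs_square_le_1 abs_le_iff)
  \<comment> \<open>Subtracting the equation for \<open>\<beta>\<close> from the norm condition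
    gives 2 q^2 = 1 - \<open>\<beta>\<close>. As \<open>q\<close> is nonzero here, the equations for
    \<open>\<alpha>\<close> and \<open>\<gamma>\<close> then determine \<open>p\<close> and
    \<open>b\<close>, and what remains to check is p^2 + b^2 = (1 + \<open>\<beta>\<close>) /
    2.\<close>
  define q where "q = sqrt ((1 - \<beta>) / 2)"
  have q: "q > 0" "q\<^sup>2 = (1 - \<beta>) / 2" using \<open>\<beta> < 1\<close> by (auto simp: q_def)
  have prod: "\<alpha>\<^sup>2 + \<gamma>\<^sup>2 = (1 - \<beta>) * (1 + \<beta>)"
    using assms by (simp add: power2_eq_square algebra_simps)
  have "(- \<alpha> / (2 * q))\<^sup>2 + (\<gamma> / (2 * q))\<^sup>2 = (\<alpha>\<^sup>2 + \<gamma>\<^sup>2) / (4 * q\<^sup>2)"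
    by (simp add: power_divide power_mult_distrib add_divide_distrib)
  also have "\<dots> = (1 + \<beta>) / 2"
    unfolding prod q(2) using \<open>\<beta> < 1\<close> by (simp add: field_simps)
  finally have pb: "(- \<alpha> / (2 * q))\<^sup>2 + (\<gamma> / (2 * q))\<^sup>2 = (1 + \<beta>) / 2" .
  show ?thesis
  proof (rule that)
    show "(- \<alpha> / (2 * q))\<^sup>2 + q\<^sup>2 + (\<gamma> / (2 * q))\<^sup>2 = 1" using pb q by argo
    show "(- \<alpha> / (2 * q))\<^sup>2 - q\<^sup>2 + (\<gamma> / (2 * q))\<^sup>2 = \<beta>" using pb q by argo
  qed (use q in auto)
qed

section \<open>Bloch coordinates of qubit states\<close>

text \<open>These are the Bloch coordinates, except that \<open>bloch_y\<close> has the opposite of the usual sign.\<close>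

definition bloch_x :: "complex mat \<Rightarrow> real" where
  "bloch_x A = 2 * Re (A $$ (0, 1))"

definition bloch_y :: "complex mat \<Rightarrow> real" where
  "bloch_y A = 2 * Im (A $$ (0, 1))"

definition bloch_z :: "complex mat \<Rightarrow> real" where
  "bloch_z A = Re (A $$ (0, 0)) - Re (A $$ (1, 1))"

lemma density_matrices_carrier:
  assumes "A \<in> density_matrices d"
  shows "A \<in> carrier_mat d d"
  using assms by (simp add: density_matrices_def positive_semidefinite_def)

text \<open>Hermiticity makes the diagonal real and the off-diagonal entries conjugate, which
  reduces later computations to polynomial identities in four real parameters.\<close>

lemma density_matrix_2_entries:
  assumes "A \<in> density_matrices 2"
  obtains p q x y where "A $$ (0, 0) = of_real p" "A $$ (1, 1) = of_real q"
    and "A $$ (0, 1) = Complex x y" "A $$ (1, 0) = Complex x (- y)"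
    and "bloch_x A = 2 * x" "bloch_y A = 2 * y" "bloch_z A = p - q"
proof (rule that)
  have "mat_adjoint A = A"
    using assms by (simp add: density_matrices_def positive_semidefinite_def)
  then have herm: "A $$ (i, j) = cnj (A $$ (j, i))" if "i < 2" "j < 2" for i j
    using mat_adjoint_index[OF density_matrices_carrier[OF assms] that] by simp
  show "A $$ (0, 0) = of_real (Re (A $$ (0, 0)))" "A $$ (1, 1) = of_real (Re (A $$ (1, 1)))"
    using herm[of 0 0] herm[of 1 1] by (auto simp: complex_eq_iff)
  show "A $$ (1, 0) = Complex (Re (A $$ (0, 1))) (- Im (A $$ (0, 1)))"
    using herm[of 1 0] by (simp add: complex_eq_iff)
qed (simp_all add: bloch_x_def bloch_y_def bloch_z_def)

lemma mult_mat_2_index: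
  assumes "A \<in> carrier_mat 2 2" "B \<in> carrier_mat 2 2" "i < 2" "j < 2"
  shows "(A * B) $$ (i, j) = A $$ (i, 0) * B $$ (0, j) + A $$ (i, 1) * B $$ (1, j)"
  using assms by (simp add: scalar_prod_def numeral_2_eq_2)

text \<open>When the matrices are expanded in the identity and the Pauli matrices, imaginary
  contributions to the trace come from products of three distinct Pauli matrices, and these add up
  to the triple product. The minus sign reflects the reversed sign of
  \<open>bloch_y\<close>.\<close>

lemma Im_trace_three_qubits:
  assumes "A \<in> density_matrices 2" "B \<in> density_matrices 2" "C \<in> density_matrices 2"
  shows "4 * Im (mat_trace (A * B * C)) =
    - ((bloch_y A * bloch_z B - bloch_z A * bloch_y B) * bloch_x C
     + (bloch_z A * bloch_x B - bloch_x A * bloch_z B) * bloch_y C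
     + (bloch_x A * bloch_y B - bloch_y A * bloch_x B) * bloch_z C)"
proof -
  have carrier: "A \<in> carrier_mat 2 2" "B \<in> carrier_mat 2 2" "C \<in> carrier_mat 2 2"
    using assms by (simp_all add: density_matrices_carrier)
  obtain p1 q1 x1 y1 where A: "A $$ (0, 0) = of_real p1" "A $$ (1, 1) = of_real q1"
    "A $$ (0, 1) = Complex x1 y1" "A $$ (1, 0) = Complex x1 (- y1)"
    "bloch_x A = 2 * x1" "bloch_y A = 2 * y1" "bloch_z A = p1 - q1"
    using density_matrix_2_entries[OF assms(1)] .
  obtain p2 q2 x2 y2 where B: "B $$ (0, 0) = of_real p2" "B $$ (1, 1) = of_real q2"
    "B $$ (0, 1) = Complex x2 y2" "B $$ (1, 0) = Complex x2 (- y2)"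
    "bloch_x B = 2 * x2" "bloch_y B = 2 * y2" "bloch_z B = p2 - q2"
    using density_matrix_2_entries[OF assms(2)] .
  obtain p3 q3 x3 y3 where C: "C $$ (0, 0) = of_real p3" "C $$ (1, 1) = of_real q3"
    "C $$ (0, 1) = Complex x3 y3" "C $$ (1, 0) = Complex x3 (- y3)"
    "bloch_x C = 2 * x3" "bloch_y C = 2 * y3" "bloch_z C = p3 - q3"
    using density_matrix_2_entries[OF assms(3)] .
  have AB: "A * B \<in> carrier_mat 2 2" using carrier by simp
  have "mat_trace (A * B * C) = (A * B * C) $$ (0, 0) + (A * B * C) $$ (1, 1)"
    using carrier by (simp add: mat_trace_def numeral_2_eq_2)
  also have "\<dots> =
      (A $$ (0, 0) * B $$ (0, 0) + A $$ (0, 1) * B $$ (1, 0)) * C $$ (0, 0)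
    + (A $$ (0, 0) * B $$ (0, 1) + A $$ (0, 1) * B $$ (1, 1)) * C $$ (1, 0)
    + ((A $$ (1, 0) * B $$ (0, 0) + A $$ (1, 1) * B $$ (1, 0)) * C $$ (0, 1)
    + (A $$ (1, 0) * B $$ (0, 1) + A $$ (1, 1) * B $$ (1, 1)) * C $$ (1, 1))"
    by (simp add: mult_mat_2_index[OF AB carrier(3)] mult_mat_2_index[OF carrier(1,2)] del: One_nat_def)
  finally have trace: "mat_trace (A * B * C) = \<dots>" .
  show ?thesis
    unfolding trace A B C by (simp add: algebra_simps)
qed

lemma braket_2:
  assumes "A \<in> carrier_mat 2 2" "w \<in> carrier_vec 2" "v \<in> carrier_vec 2"
  shows "braket w A v =
    (A $$ (0, 0) * v $ 0 + A $$ (0, 1) * v $ 1) * cnj (w $ 0)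
  + (A $$ (1, 0) * v $ 0 + A $$ (1, 1) * v $ 1) * cnj (w $ 1)"
  using assms by (simp add: braket_def scalar_prod_def numeral_2_eq_2)

section \<open>A common real basis for coplanar Bloch vectors\<close>

text \<open>The basis is chosen so that the imaginary part of the off-diagonal element of each state
  is half the inner product of its Bloch vector with the common unit normal, hence zero. Diagonal
  elements are real by hermiticity.\<close>

lemma qubits_real_basis_if_real_traces:
  assumes traces: "\<And>k l m. k \<in> K \<Longrightarrow> l \<in> K \<Longrightarrow> m \<in> K \<Longrightarrow> mat_trace (\<rho> k * \<rho> l * \<rho> m) \<in> \<real>"
    and dens: "\<And>k. k \<in> K \<Longrightarrow> \<rho> k \<in> density_matrices 2"
  obtains a where "orthonormal_basis 2 a"
    and "\<And>k i j. k \<in> K \<Longrightarrow> i < 2 \<Longrightarrow> j < 2 \<Longrightarrow> braket (a i) (\<rho> k) (a j) \<in> \<real>"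
proof -
  have coplanar:
    "(bloch_y (\<rho> k) * bloch_z (\<rho> l) - bloch_z (\<rho> k) * bloch_y (\<rho> l)) * bloch_x (\<rho> m)
   + (bloch_z (\<rho> k) * bloch_x (\<rho> l) - bloch_x (\<rho> k) * bloch_z (\<rho> l)) * bloch_y (\<rho> m)
   + (bloch_x (\<rho> k) * bloch_y (\<rho> l) - bloch_y (\<rho> k) * bloch_x (\<rho> l)) * bloch_z (\<rho> m) = 0"
    if "k \<in> K" "l \<in> K" "m \<in> K" for k l m
  proof -
    have "4 * Im (mat_trace (\<rho> k * \<rho> l * \<rho> m)) = 0"
      using traces[OF that] by (simp add: complex_is_Real_iff)
    then show ?thesis
      unfolding Im_trace_three_qubits[OF dens[OF that(1)] dens[OF that(2)] dens[OF that(3)]]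
      by (rule iffD1[OF neg_equal_0_iff_equal])
  qed
  \<comment> \<open>The coordinates are passed in the order y, z, x in which they first occur in the
    triple product, so each keeps its own role.\<close>
  obtain \<alpha> \<beta> \<gamma> where unit: "\<alpha>\<^sup>2 + \<beta>\<^sup>2 + \<gamma>\<^sup>2 = 1"
    and orth: "\<And>m. m \<in> K \<Longrightarrow> \<alpha> * bloch_x (\<rho> m) + \<beta> * bloch_y (\<rho> m) + \<gamma> * bloch_z (\<rho> m) = 0"
    by (rule coplanar_unit_normal[of K "\<lambda>k. bloch_y (\<rho> k)" "\<lambda>k. bloch_z (\<rho> k)" "\<lambda>k. bloch_x (\<rho> k)",
        OF coplanar]) blast+
  obtain p q b where norm: "p\<^sup>2 + q\<^sup>2 + b\<^sup>2 = 1"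
    and coords: "- 2 * p * q = \<alpha>" "p\<^sup>2 - q\<^sup>2 + b\<^sup>2 = \<beta>" "2 * q * b = \<gamma>"
    by (rule unit_vector_parametrization[OF unit])
  \<comment> \<open>The two vectors are the columns of a matrix in SU(2) with real lower left entry,
    so orthonormality comes down to \<open>norm\<close>.\<close>
  define a where "a i = vec 2 (\<lambda>j.
      if i = 0 then if j = 0 then Complex p q else of_real b
      else if j = 0 then - of_real b else Complex p (- q))" for i :: nat
  have ac: "a i \<in> carrier_vec 2" for i by (simp add: a_def)
  have entries: "a 0 $ 0 = Complex p q" "a 0 $ 1 = of_real b"
      "a 1 $ 0 = - of_real b" "a 1 $ 1 = Complex p (- q)"
    by (simp_all add: a_def)
  have prod: "a i \<bullet>c a j = a i $ 0 * cnj (a j $ 0) + a i $ 1 * cnj (a j $ 1)" for i j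
    using ac[of i] ac[of j] by (simp add: scalar_prod_def numeral_2_eq_2)
  have orthonormal: "a i \<bullet>c a j = (if i = j then 1 else 0)" if "i < 2" "j < 2" for i j
  proof -
    have "i = 0 \<or> i = 1" "j = 0 \<or> j = 1" using that by auto
    then show ?thesis
      using norm by (auto simp: prod entries complex_eq_iff power2_eq_square simp del: One_nat_def)
  qed
  have real: "braket (a i) (\<rho> k) (a j) \<in> \<real>" if k: "k \<in> K" and ij: "i < 2" "j < 2" for k i j
  proof -
    obtain u v x y where R: "\<rho> k $$ (0, 0) = of_real u" "\<rho> k $$ (1, 1) = of_real v"
      "\<rho> k $$ (0, 1) = Complex x y" "\<rho> k $$ (1, 0) = Complex x (- y)"
      "bloch_x (\<rho> k) = 2 * x" "bloch_y (\<rho> k) = 2 * y" "bloch_z (\<rho> k) = u - v"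
      using density_matrix_2_entries[OF dens[OF k]] .
    note br = braket_2[OF density_matrices_carrier[OF dens[OF k]] ac ac]
    have "2 * Im (braket (a 0) (\<rho> k) (a 1)) =
        \<alpha> * bloch_x (\<rho> k) + \<beta> * bloch_y (\<rho> k) + \<gamma> * bloch_z (\<rho> k)"
      unfolding br R entries coords[symmetric] by (simp add: algebra_simps power2_eq_square)
    then have 01: "Im (braket (a 0) (\<rho> k) (a 1)) = 0"
      using orth[OF k] by simp
    have 10: "Im (braket (a 1) (\<rho> k) (a 0)) = - Im (braket (a 0) (\<rho> k) (a 1))"
      unfolding br R entries by (simp add: algebra_simps)
    have 00: "Im (braket (a 0) (\<rho> k) (a 0)) = 0"
      unfolding br R entries by (simp add: algebra_simps)
    have 11: "Im (braket (a 1) (\<rho> k) (a 1)) = 0"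
      unfolding br R entries by (simp add: algebra_simps)
    have "i = 0 \<or> i = 1" "j = 0 \<or> j = 1" using ij by auto
    then show ?thesis
      using 00 01 10 11 by (auto simp: complex_is_Real_iff simp del: One_nat_def)
  qed
  show ?thesis
    using that[OF orthonormal_basisI[OF ac orthonormal] real] by blast
qed

section \<open>Freeness of qubit tuples and triple traces\<close>

theorem mainTheorem6:
  fixes n :: nat and \<rho> :: "nat \<Rightarrow> complex mat"
  assumes "1 \<le> n"
    and "\<rho> \<in> {1..n} \<rightarrow>\<^sub>E density_matrices 2"
  shows "\<rho> \<notin> imaginarity_free n 2 \<longleftrightarrow>
    (\<exists>k\<in>{1..n}. \<exists>l\<in>{1..n}. \<exists>m\<in>{1..n}. mat_trace (\<rho> k * \<rho> l * \<rho> m) \<notin> B3_real)"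
proof
  assume nfree: "\<rho> \<notin> imaginarity_free n 2"
  have dens: "\<rho> k \<in> density_matrices 2" if "k \<in> {1..n}" for k
    using assms(2) that by (rule PiE_mem)
  show "\<exists>k\<in>{1..n}. \<exists>l\<in>{1..n}. \<exists>m\<in>{1..n}. mat_trace (\<rho> k * \<rho> l * \<rho> m) \<notin> B3_real"
  proof (rule ccontr)
    assume "\<not> ?thesis"
    \<comment> \<open>Membership of all traces in \<open>B3_real\<close> is used through their being
      real, which makes the Bloch vectors coplanar.\<close>
    then have traces: "mat_trace (\<rho> k * \<rho> l * \<rho> m) \<in> \<real>"
      if "k \<in> {1..n}" "l \<in> {1..n}" "m \<in> {1..n}" for k l m
      using that B3_real_subset_Reals by blast
    obtain a where "orthonormal_basis 2 a"
      and "\<And>k i j. k \<in> {1..n} \<Longrightarrow> i < 2 \<Longrightarrow> j < 2 \<Longrightarrow> braket (a i) (\<rho> k) (a j) \<in> \<real>"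
      by (rule qubits_real_basis_if_real_traces[of "{1..n}" \<rho>, OF traces dens]) blast+
    then have "\<rho> \<in> imaginarity_free n 2"
      using assms(2) unfolding imaginarity_free_def by blast
    then show False
      using nfree by contradiction
  qed
next
  assume "\<exists>k\<in>{1..n}. \<exists>l\<in>{1..n}. \<exists>m\<in>{1..n}. mat_trace (\<rho> k * \<rho> l * \<rho> m) \<notin> B3_real"
  then obtain k l m where klm: "k \<in> {1..n}" "l \<in> {1..n}" "m \<in> {1..n}"
    and nB: "mat_trace (\<rho> k * \<rho> l * \<rho> m) \<notin> B3_real" by blast
  show "\<rho> \<notin> imaginarity_free n 2"
  proof
    assume free: "\<rho> \<in> imaginarity_free n 2"
    \<comment> \<open>The chosen entries, possibly with repetitions, form a triple that is free in
      the same basis, so its trace lies in \<open>B3_real\<close> with dimension 2. The last branch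
      of \<open>s\<close> keeps every value in \<open>{1..n}\<close>, and \<open>restrict\<close>
      makes the triple extensional.\<close>
    define s where "s i = (if i = 1 then k else if i = 2 then l else m)" for i :: nat
    define \<tau> where "\<tau> = restrict (\<rho> \<circ> s) {1..3}"
    have s: "s i \<in> {1..n}" for i using klm by (simp add: s_def)
    obtain a where "orthonormal_basis 2 a"
      and a: "\<And>k i j. k \<in> {1..n} \<Longrightarrow> i < 2 \<Longrightarrow> j < 2 \<Longrightarrow> braket (a i) (\<rho> k) (a j) \<in> \<real>"
      using free unfolding imaginarity_free_def by blast
    moreover have "\<tau> \<in> {1..3} \<rightarrow>\<^sub>E density_matrices 2"
      using PiE_mem[OF assms(2) s] by (simp add: \<tau>_def)
    moreover have "braket (a i) (\<tau> t) (a j) \<in> \<real>" if "t \<in> {1..3}" "i < 2" "j < 2" for t i j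
      using a[OF s that(2,3)] that(1) by (simp add: \<tau>_def)
    ultimately have "\<tau> \<in> imaginarity_free 3 2"
      unfolding imaginarity_free_def by blast
    then have "mat_trace (\<tau> 1 * \<tau> 2 * \<tau> 3) \<in> B3_real"
      unfolding B3_real_def by blast
    then show False using nB by (simp add: \<tau>_def s_def)
  qed
qed

end
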